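(* Let $Q$ and $F$ be probability measures on $\mathbb N_0$ and $\mathbb N=\{1,2,\dots\}$ respectively, let $N$ have law $Q$, let $(J_i)_{i\ge1}$ be i.i.d. with law $F$, independent of $N$, and let $X=\sum_{i=1}^N J_i$. Assume $F$ is PF$_2$. Then the posterior kernel $(n,k)\mapsto\mathbb P(N=n\mid X=k)$ is TP$_2$ on $\mathbb N_0\times\operatorname{supp}(X)$. In particular, the conditional laws of $N$ given $X=k$ are stochastically increasing in $k$, and $k\mapsto\mathbb E[N\mid X=k]$ is nondecreasing on $\operatorname{supp}(X)$.
   Context: $\mathbb N_0=\{0\}\cup\mathbb N$; $\operatorname{supp}(X)=\{k\in\mathbb N_0:\mathbb P(X=k)>0\}$; the empty sum is $0$. PF$_2$: a sequence $(b_k)_{k\in\mathbb Z}$ is PF$_2$ if $b_k\ge0$ for all $k$, the support $\{k:b_k>0\}$ is an interval in $\mathbb Z$, and $b$ is log-concave on its support, i.e. $\log b_{k+2}-2\log b_{k+1}+\log b_k\le0$ whenever $k,k+1,k+2$ lie in the support. A probability distribution on $\mathbb N_0$ is PF$_2$ if its mass sequence, extended by zero outside its support, is PF$_2$. TP$_2$: a nonnegative function $M:I\times J\to[0,\infty)$ on a product of totally ordered sets is TP$_2$ if $M(i,j)M(i',j')\ge M(i,j')M(i',j)$ whenever $i\le i'$ and $j\le j'$. Stochastically increasing in $k$: for $k\le k'$ in $\operatorname{supp}(X)$, $\mathbb P(N\ge n\mid X=k)\le\mathbb P(N\ge n\mid X=k')$ for all $n$. *)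

theory Defs
  imports "HOL-Probability.Probability"
begin

definition PF2 :: "(int \<Rightarrow> real) \<Rightarrow> bool" where
  "PF2 b \<longleftrightarrow>
     (\<forall>k. b k \<ge> 0) \<and>
     (\<forall>i j k. i \<le> j \<and> j \<le> k \<and> b i > 0 \<and> b k > 0 \<longrightarrow> b j > 0) \<and>
     (\<forall>k. b k > 0 \<and> b (k + 1) > 0 \<and> b (k + 2) > 0 \<longrightarrow>
        ln (b (k + 2)) - 2 * ln (b (k + 1)) + ln (b k) \<le> 0)"

definition PF2_pmf :: "nat pmf \<Rightarrow> bool" where
  "PF2_pmf p \<longleftrightarrow> PF2 (\<lambda>k. if k \<ge> 0 then pmf p (nat k) else 0)"

definition TP2_on :: "'a::linorder set \<Rightarrow> 'b::linorder set \<Rightarrow> ('a \<Rightarrow> 'b \<Rightarrow> real) \<Rightarrow> bool" where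
  "TP2_on I J K \<longleftrightarrow>
     (\<forall>i\<in>I. \<forall>j\<in>J. K i j \<ge> 0) \<and>
     (\<forall>i\<in>I. \<forall>i'\<in>I. \<forall>j\<in>J. \<forall>j'\<in>J. i \<le> i' \<and> j \<le> j' \<longrightarrow>
        K i j * K i' j' \<ge> K i j' * K i' j)"

text \<open>
  The library's independence of two random variables requires them to have values in the same
  type; this version does not.
\<close>

definition indep_rv :: "'a measure \<Rightarrow> 'b measure \<Rightarrow> ('a \<Rightarrow> 'b) \<Rightarrow> 'c measure \<Rightarrow> ('a \<Rightarrow> 'c) \<Rightarrow> bool" where
  "indep_rv M S Y T Z \<longleftrightarrow>
     Y \<in> measurable M S \<and> Z \<in> measurable M T \<and>
     prob_space.indep_set M {Y -` A \<inter> space M | A. A \<in> sets S} {Z -` A \<inter> space M | A. A \<in> sets T}"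

definition supp_rv :: "'a measure \<Rightarrow> ('a \<Rightarrow> nat) \<Rightarrow> nat set" where
  "supp_rv M X = {k. \<P>(\<omega> in M. X \<omega> = k) > 0}"

text \<open>
  The elementary conditional expectation of \<open>Y\<close> given the event that \<open>X = k\<close>: the mean of \<open>Y\<close>
  under the conditional probability measure. As a Bochner integral it is \<open>0\<close> when \<open>Y\<close> is not
  integrable under that measure, so integrability has to be claimed separately.
\<close>

definition cond_mean :: "'a measure \<Rightarrow> ('a \<Rightarrow> real) \<Rightarrow> ('a \<Rightarrow> nat) \<Rightarrow> nat \<Rightarrow> real" where
  "cond_mean M Y X k = (\<integral>\<omega>. Y \<omega> \<partial>uniform_measure M {\<omega> \<in> space M. X \<omega> = k})"

end

theory Submission
  imports Defs
begin

text \<open>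
  By independence, \<open>P(N = n, X = k) = Q(n) c(n, k)\<close>, where \<open>c(n, k)\<close> is the mass at \<open>k\<close> of the
  \<open>n\<close>-fold convolution power of \<open>F\<close> (\<open>prob_compound_sum_eq\<close>). Dividing by \<open>P(X = k)\<close> and
  multiplying by \<open>Q(n)\<close> rescales columns and rows by nonnegative factors, which preserves TP2, so
  everything rests on the kernel \<open>c\<close>.

  In terms of the generating series \<open>a\<close> of \<open>F\<close>, \<open>c(n, k)\<close> is the coefficient of \<open>a ^ n\<close> at \<open>k\<close>.
  A series acts by multiplication through its upper triangular Toeplitz matrix, with entries
  \<open>a_(j - i)\<close>, and PF2 says that this matrix is TP2 (\<open>PF2_pmf_TP2_toeplitz\<close>). Since products of
  TP2 kernels are TP2 (\<open>TP2_on_compose\<close>, the \<open>2 \<times> 2\<close> case of the Cauchy--Binet formula), the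
  Toeplitz matrix of every \<open>a ^ n\<close> is TP2 as well. Writing \<open>a ^ (d + n) = a ^ d * a ^ n\<close> exhibits
  row \<open>d + n\<close> of \<open>c\<close> as a nonnegative combination of the rows of the Toeplitz matrix of \<open>a ^ n\<close>,
  whose top row is row \<open>n\<close> of \<open>c\<close>; the required inequality between the two rows is a combination
  of \<open>2 \<times> 2\<close> minors of that matrix that involve its top row (\<open>TP2_fps_power\<close>).

  Summing the TP2 inequality over \<open>m < n \<le> m'\<close> compares the tails of the posteriors, which gives
  stochastic monotonicity (\<open>TP2_stochastically_increasing\<close>). As every jump is at least \<open>1\<close>,
  \<open>N \<le> X\<close> almost surely; hence each posterior has bounded support, its mean exists, and the mean
  is the finite sum of its tails, which increase with \<open>k\<close>.
\<close>

section \<open>Total positivity of order two\<close>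

text \<open>
  A \<open>2 \<times> 2\<close> minor of the product is a double sum over pairs \<open>(j, l)\<close>. Adding to each term the one
  with \<open>j\<close> and \<open>l\<close> exchanged turns it into a product of a minor of \<open>A\<close> and a minor of \<open>B\<close> on the
  same pair; these are both nonnegative if \<open>j \<le> l\<close> and both nonpositive otherwise.
\<close>

lemma TP2_on_compose:
  assumes A: "TP2_on I J A" and B: "TP2_on J K B" and fin: "finite J"
  shows "TP2_on I K (\<lambda>i k. \<Sum>j\<in>J. A i j * B j k)"
  unfolding TP2_on_def
proof (intro conjI ballI impI)
  fix i k assume "i \<in> I" "k \<in> K"
  then show "0 \<le> (\<Sum>j\<in>J. A i j * B j k)"
    using A B unfolding TP2_on_def by (intro sum_nonneg mult_nonneg_nonneg) auto
next
  fix i i' k k' assume mem: "i \<in> I" "i' \<in> I" "k \<in> K" "k' \<in> K" and le: "i \<le> i' \<and> k \<le> k'"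
  let ?C = "\<lambda>i k. \<Sum>j\<in>J. A i j * B j k"
  let ?a = "\<lambda>j l. A i j * A i' l - A i l * A i' j"
  let ?b = "\<lambda>j l. B j k * B l k' - B j k' * B l k"
  let ?t = "\<lambda>j l. A i j * A i' l * ?b j l"
  have det: "?C i k * ?C i' k' - ?C i k' * ?C i' k = (\<Sum>j\<in>J. \<Sum>l\<in>J. ?t j l)"
    unfolding sum_product sum_subtractf[symmetric]
    by (intro sum.cong refl) (simp add: algebra_simps)
  have "(\<Sum>j\<in>J. \<Sum>l\<in>J. ?t j l) = (\<Sum>j\<in>J. \<Sum>l\<in>J. ?t l j)"
    by (rule sum.swap)
  then have "2 * (\<Sum>j\<in>J. \<Sum>l\<in>J. ?t j l) = (\<Sum>j\<in>J. \<Sum>l\<in>J. ?t j l + ?t l j)"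
    by (simp add: sum.distrib)
  also have "\<dots> = (\<Sum>j\<in>J. \<Sum>l\<in>J. ?a j l * ?b j l)"
    by (intro sum.cong refl) (simp add: algebra_simps)
  also have "\<dots> \<ge> 0"
  proof (intro sum_nonneg)
    fix j l assume jl: "j \<in> J" "l \<in> J"
    show "0 \<le> ?a j l * ?b j l"
    proof (cases "j \<le> l")
      case True
      then have "?a j l \<ge> 0" "?b j l \<ge> 0"
        using A B mem le jl unfolding TP2_on_def diff_ge_0_iff_ge by blast+
      then show ?thesis by (rule mult_nonneg_nonneg)
    next
      case False
      then have "l \<le> j" by simp
      then have "?a l j \<ge> 0" "?b l j \<ge> 0"
        using A B mem le jl unfolding TP2_on_def diff_ge_0_iff_ge by blast+
      then have "?a j l \<le> 0" "?b j l \<le> 0" by (simp_all add: mult.commute)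
      then show ?thesis by (rule mult_nonpos_nonpos)
    qed
  qed
  finally show "?C i k * ?C i' k' \<ge> ?C i k' * ?C i' k" using det by linarith
qed

text \<open>
  A TP2 family of probability vectors is ordered by the monotone likelihood ratio, and summing the
  likelihood ratio inequality over all pairs on either side of \<open>n\<close> yields the tail inequality.
\<close>

lemma TP2_stochastically_increasing:
  fixes w :: "nat \<Rightarrow> 'b::linorder \<Rightarrow> real"
  assumes TP2: "TP2_on UNIV S w" and k: "k \<in> S" "k' \<in> S" "k \<le> k'"
    and mass: "(\<Sum>m\<le>K. w m k) = 1" "(\<Sum>m\<le>K. w m k') = 1"
  shows "(\<Sum>m\<in>{n..K}. w m k) \<le> (\<Sum>m\<in>{n..K}. w m k')"
proof (cases "n \<le> K")
  case True
  let ?A = "\<lambda>k. \<Sum>m<n. w m k" and ?B = "\<lambda>k. \<Sum>m\<in>{n..K}. w m k"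
  have "{..K} = {..<n} \<union> {n..K}" using True by auto
  then have split: "(\<Sum>m\<le>K. w m x) = ?A x + ?B x" for x
    by (simp add: sum.union_disjoint ivl_disj_int)
  have "?A k' * ?B k \<le> ?A k * ?B k'"
    unfolding sum_product
  proof (intro sum_mono)
    fix m m' assume "m \<in> {..<n}" "m' \<in> {n..K}"
    then have "m \<le> m'" by simp
    then show "w m k' * w m' k \<le> w m k * w m' k'"
      using TP2 k unfolding TP2_on_def by blast
  qed
  moreover have "?A k = 1 - ?B k" "?A k' = 1 - ?B k'"
    using mass split[of k] split[of k'] by linarith+
  \<comment> \<open>With total mass \<open>1\<close>, \<open>A k * B k' - A k' * B k\<close> is just \<open>B k' - B k\<close>.\<close>
  ultimately show ?thesis by (simp add: algebra_simps)
qed simp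

section \<open>Convolution powers of a log-concave sequence\<close>

text \<open>
  The matrix by which multiplication with \<open>a\<close> acts on coefficient sequences, written as row vectors.
  Its indices are natural numbers, so that a series product is a matrix product with finitely
  many nonzero terms in each entry.
\<close>

definition toeplitz :: "real fps \<Rightarrow> nat \<Rightarrow> nat \<Rightarrow> real" where
  "toeplitz a i j = (if i \<le> j then fps_nth a (j - i) else 0)"

lemma toeplitz_0: "toeplitz a 0 k = fps_nth a k"
  by (simp add: toeplitz_def)

lemma toeplitz_mult:
  assumes "j \<le> K"
  shows "toeplitz (a * b) i j = (\<Sum>m\<le>K. toeplitz a i m * toeplitz b m j)"
proof (cases "i \<le> j")
  case True
  have "(\<Sum>m\<le>K. toeplitz a i m * toeplitz b m j)
      = (\<Sum>m\<in>{i..j}. fps_nth a (m - i) * fps_nth b (j - m))"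
    using assms by (intro sum.mono_neutral_cong_right) (auto simp: toeplitz_def)
  also have "\<dots> = (\<Sum>l = 0..j - i. fps_nth a l * fps_nth b (j - i - l))"
    by (rule sum.reindex_bij_witness[of _ "\<lambda>l. l + i" "\<lambda>m. m - i"]) (use True in auto)
  finally show ?thesis using True by (simp add: toeplitz_def fps_mult_nth)
next
  case False
  then have "(\<Sum>m\<le>K. toeplitz a i m * toeplitz b m j) = 0"
    by (intro sum.neutral) (auto simp: toeplitz_def)
  with False show ?thesis by (simp add: toeplitz_def)
qed

lemma TP2_toeplitz_mult:
  assumes "TP2_on UNIV UNIV (toeplitz a)" "TP2_on UNIV UNIV (toeplitz b)"
  shows "TP2_on UNIV UNIV (toeplitz (a * b))"
proof -
  \<comment> \<open>Truncating the columns keeps the matrix product a finite sum with a common index set.\<close>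
  have *: "TP2_on UNIV {..K} (toeplitz (a * b))" for K
  proof -
    have "TP2_on UNIV {..K} (\<lambda>i j. \<Sum>m\<in>{..K}. toeplitz a i m * toeplitz b m j)"
      using assms by (intro TP2_on_compose) (auto simp: TP2_on_def)
    then show ?thesis by (simp add: TP2_on_def toeplitz_mult[of _ K])
  qed
  show ?thesis
    unfolding TP2_on_def
  proof (intro conjI ballI impI)
    show "0 \<le> toeplitz (a * b) i j" for i j
      using *[of j] by (auto simp: TP2_on_def)
    show "toeplitz (a * b) i j' * toeplitz (a * b) i' j
        \<le> toeplitz (a * b) i j * toeplitz (a * b) i' j'"
      if "i \<le> i' \<and> j \<le> j'" for i i' j j'
      using *[of j'] that by (auto simp: TP2_on_def)
  qed
qed

lemma TP2_toeplitz_power: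
  assumes "TP2_on UNIV UNIV (toeplitz a)"
  shows "TP2_on UNIV UNIV (toeplitz (a ^ n))"
proof (induction n)
  case 0
  show ?case by (auto simp: TP2_on_def toeplitz_def)
next
  case (Suc n)
  then show ?case using assms by (simp add: TP2_toeplitz_mult)
qed

text \<open>
  This is more than the TP2 property of each Toeplitz matrix, as it compares coefficients of
  different powers. The later row is a nonnegative combination of rows of the Toeplitz matrix of the
  earlier power, and the earlier row is its top row.
\<close>

lemma TP2_fps_power:
  assumes "TP2_on UNIV UNIV (toeplitz a)"
  shows "TP2_on UNIV UNIV (\<lambda>n k. fps_nth (a ^ n) k)"
proof -
  have nonneg: "0 \<le> fps_nth (a ^ n) k" for n k
    using TP2_toeplitz_power[OF assms, of n] unfolding TP2_on_def toeplitz_0[symmetric] by blast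
  have "fps_nth (a ^ n) k' * fps_nth (a ^ n') k \<le> fps_nth (a ^ n) k * fps_nth (a ^ n') k'"
    if le: "n \<le> n'" "k \<le> k'" for n n' k k'
  proof -
    obtain d where d: "n' = d + n" using le(1) by (metis le_Suc_ex add.commute)
    have expand: "fps_nth (a ^ n') j = (\<Sum>m\<le>k'. fps_nth (a ^ d) m * toeplitz (a ^ n) m j)"
      if "j \<le> k'" for j
      using toeplitz_mult[OF that, of "a ^ d" "a ^ n" 0] by (simp add: d power_add toeplitz_0)
    have "toeplitz (a ^ n) 0 k' * toeplitz (a ^ n) m k \<le> toeplitz (a ^ n) 0 k * toeplitz (a ^ n) m k'"
      for m
      using TP2_toeplitz_power[OF assms, of n] le(2) unfolding TP2_on_def by blast
    then have "fps_nth (a ^ d) m * (fps_nth (a ^ n) k' * toeplitz (a ^ n) m k)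
        \<le> fps_nth (a ^ d) m * (fps_nth (a ^ n) k * toeplitz (a ^ n) m k')" for m
      unfolding toeplitz_0 by (intro mult_left_mono nonneg)
    then show ?thesis
      unfolding expand[OF le(2)] expand[OF order_refl] sum_distrib_left
        mult.left_commute[of "fps_nth (a ^ n) _"]
      by (rule sum_mono)
  qed
  with nonneg show ?thesis by (simp add: TP2_on_def)
qed

text \<open>
  Log-concavity says that the ratio \<open>f (k + 1) / f k\<close> decreases on the support, so a shift by \<open>d\<close>
  multiplies \<open>f a\<close> by at least as much as \<open>f b\<close>. The absence of gaps in the support lets the local
  inequalities be chained: between two positive values one may divide by all intermediate ones.
\<close>

lemma log_concave_shift_le:
  fixes f :: "nat \<Rightarrow> real"
  assumes nonneg: "\<And>k. 0 \<le> f k"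
    and gapless: "\<And>i j k. i \<le> j \<Longrightarrow> j \<le> k \<Longrightarrow> 0 < f i \<Longrightarrow> 0 < f k \<Longrightarrow> 0 < f j"
    and local: "\<And>k. f k * f (k + 2) \<le> (f (k + 1))\<^sup>2"
    and "a \<le> b"
  shows "f a * f (b + d) \<le> f (a + d) * f b"
proof -
  have step: "f a * f (a + m + 1) \<le> f (a + 1) * f (a + m)" for a m
  proof (induction m)
    case 0
    show ?case by simp
  next
    case (Suc m)
    show ?case
    proof (cases "0 < f a \<and> 0 < f (a + m + 2)")
      case False
      then have "f a = 0 \<or> f (a + m + 2) = 0" using nonneg by (metis less_eq_real_def)
      then show ?thesis using nonneg by auto
    next
      case True
      then have pos: "0 < f (a + m)" "0 < f (a + m + 1)"
        using gapless[of a _ "a + m + 2"] by auto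
      have "(f a * f (a + m + 1)) * (f (a + m) * f (a + m + 2))
          \<le> (f (a + 1) * f (a + m)) * (f (a + m + 1))\<^sup>2"
        by (rule mult_mono[OF Suc.IH local]) (simp_all add: nonneg)
      then have "(f (a + m) * f (a + m + 1)) * (f a * f (a + m + 2))
          \<le> (f (a + m) * f (a + m + 1)) * (f (a + 1) * f (a + m + 1))"
        by (simp add: power2_eq_square mult_ac)
      then show ?thesis using pos by (simp add: mult_le_cancel_left_pos)
    qed
  qed
  show ?thesis
    using \<open>a \<le> b\<close>
  proof (induction d arbitrary: a)
    case 0
    show ?case by simp
  next
    case (Suc d)
    show ?case
    proof (cases "a = b")
      case True
      then show ?thesis by simp
    next
      case False
      have "f a * f (b + Suc d) \<le> f (a + 1) * f (b + d)"
        using step[of a "b + d - a"] Suc.prems by simp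
      also have "\<dots> \<le> f (a + Suc d) * f b"
        using Suc.IH[of "a + 1"] Suc.prems False by simp
      finally show ?thesis .
    qed
  qed
qed

text \<open>
  The minor on rows \<open>i \<le> i'\<close> and columns \<open>j \<le> j'\<close> is an instance of the shift inequality if
  \<open>i' \<le> j\<close>; otherwise the negative term of the minor contains an entry below the diagonal.
\<close>

lemma PF2_pmf_TP2_toeplitz:
  assumes "PF2_pmf p"
  shows "TP2_on UNIV UNIV (toeplitz (Abs_fps (pmf p)))"
proof -
  let ?b = "\<lambda>k::int. if k \<ge> 0 then pmf p (nat k) else 0"
  have PF2: "PF2 ?b" using assms by (simp add: PF2_pmf_def)
  have gapless: "0 < pmf p j" if "i \<le> j" "j \<le> k" "0 < pmf p i" "0 < pmf p k" for i j k
  proof -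
    have "int i \<le> int j \<and> int j \<le> int k \<and> ?b (int i) > 0 \<and> ?b (int k) > 0 \<longrightarrow> ?b (int j) > 0"
      using PF2 unfolding PF2_def by blast
    then show ?thesis using that by simp
  qed
  have local: "pmf p k * pmf p (k + 2) \<le> (pmf p (k + 1))\<^sup>2" for k
  proof (cases "0 < pmf p k \<and> 0 < pmf p (k + 2)")
    case False
    then have "pmf p k = 0 \<or> pmf p (k + 2) = 0" by (metis pmf_nonneg less_eq_real_def)
    then show ?thesis by auto
  next
    case True
    have pos: "0 < pmf p (k + 1)" using gapless[of k "k + 1" "k + 2"] True by simp
    have nats: "nat (int k + 1) = k + 1" "nat (int k + 2) = k + 2" by auto
    have "?b (int k) > 0 \<and> ?b (int k + 1) > 0 \<and> ?b (int k + 2) > 0 \<longrightarrow>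
        ln (?b (int k + 2)) - 2 * ln (?b (int k + 1)) + ln (?b (int k)) \<le> 0"
      using PF2 unfolding PF2_def by blast
    then have "ln (pmf p k) + ln (pmf p (k + 2)) \<le> 2 * ln (pmf p (k + 1))"
      using True pos by (simp add: nats)
    then have "ln (pmf p k * pmf p (k + 2)) \<le> ln ((pmf p (k + 1))\<^sup>2)"
      using True pos by (simp add: ln_mult ln_realpow)
    then show ?thesis using True pos by simp
  qed
  show ?thesis
    unfolding TP2_on_def
  proof (intro conjI ballI impI)
    show "0 \<le> toeplitz (Abs_fps (pmf p)) i j" for i j by (simp add: toeplitz_def)
  next
    fix i i' j j' :: nat assume le: "i \<le> i' \<and> j \<le> j'"
    let ?T = "toeplitz (Abs_fps (pmf p))"
    show "?T i j' * ?T i' j \<le> ?T i j * ?T i' j'"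
    proof (cases "i' \<le> j")
      case False
      then show ?thesis by (simp add: toeplitz_def)
    next
      case True
      \<comment> \<open>The four entries sit at \<open>j - i' \<le> j - i\<close> and at both positions shifted by \<open>j' - j\<close>.\<close>
      have "pmf p (j - i') * pmf p ((j - i) + (j' - j)) \<le> pmf p ((j - i') + (j' - j)) * pmf p (j - i)"
        using le by (intro log_concave_shift_le[OF pmf_nonneg _ local]) (auto intro: gapless)
      moreover have "(j - i) + (j' - j) = j' - i" "(j - i') + (j' - j) = j' - i'"
        using le True by auto
      ultimately show ?thesis using le True by (simp add: toeplitz_def mult.commute)
    qed
  qed
qed

section \<open>Random sums\<close>

lemma (in prob_space) prob_iid_sum_eq:
  fixes J :: "'i \<Rightarrow> 'a \<Rightarrow> nat"
  assumes "finite I" "indep_vars (\<lambda>_. count_space UNIV) J I"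
    and "\<And>i. i \<in> I \<Longrightarrow> distr M (count_space UNIV) (J i) = measure_pmf F"
  shows "\<P>(\<omega> in M. (\<Sum>i\<in>I. J i \<omega>) = k) = fps_nth (Abs_fps (pmf F) ^ card I) k"
  using assms
proof (induction I arbitrary: k rule: finite_induct)
  case empty
  show ?case by (simp add: prob_space)
next
  case (insert i I)
  let ?S = "\<lambda>\<omega>. \<Sum>i\<in>I. J i \<omega>"
  have meas: "J l \<in> measurable M (count_space UNIV)" if "l \<in> insert i I" for l
    using insert.prems(1) that by (auto simp: indep_vars_def)
  have [measurable]: "J i \<in> measurable M (count_space UNIV)" "?S \<in> measurable M (count_space UNIV)"
    using meas by auto
  have IH: "\<P>(\<omega> in M. ?S \<omega> = l) = fps_nth (Abs_fps (pmf F) ^ card I) l" for l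
    using insert.prems by (intro insert.IH) (auto intro: indep_vars_subset)
  have law: "\<P>(\<omega> in M. J i \<omega> = j) = pmf F j" for j
  proof -
    have "\<P>(\<omega> in M. J i \<omega> = j) = measure (distr M (count_space UNIV) (J i)) {j}"
      by (subst measure_distr) (auto intro!: arg_cong[where f=prob])
    then show ?thesis using insert.prems(2)[of i] by (simp add: pmf.rep_eq)
  qed
  \<comment> \<open>Real values, because \<open>indep_vars_sum\<close> concerns sums of real variables.\<close>
  have "indep_vars (\<lambda>_. borel) (\<lambda>i \<omega>. real (J i \<omega>)) (insert i I)"
    using indep_vars_compose2[OF insert.prems(1), of "\<lambda>_. real" "\<lambda>_. borel"] by simp
  then have indep: "indep_var borel (\<lambda>\<omega>. real (J i \<omega>)) borel (\<lambda>\<omega>. \<Sum>i\<in>I. real (J i \<omega>))"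
    using insert.hyps by (intro indep_vars_sum)
  have joint: "\<P>(\<omega> in M. J i \<omega> = j \<and> ?S \<omega> = l) = \<P>(\<omega> in M. J i \<omega> = j) * \<P>(\<omega> in M. ?S \<omega> = l)"
    for j l
  proof -
    have "(\<Sum>i\<in>I. real (J i \<omega>)) = real (?S \<omega>)" for \<omega> by simp
    then show ?thesis
      using indep_varD[OF indep, of "{real j}" "{real l}"]
      by (simp add: vimage_def Int_def conj_commute del: of_nat_sum)
  qed
  have "{\<omega> \<in> space M. (\<Sum>i\<in>insert i I. J i \<omega>) = k}
      = (\<Union>j\<in>{0..k}. {\<omega> \<in> space M. J i \<omega> = j \<and> ?S \<omega> = k - j})"
    using insert.hyps by auto
  then have "\<P>(\<omega> in M. (\<Sum>i\<in>insert i I. J i \<omega>) = k)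
      = (\<Sum>j = 0..k. \<P>(\<omega> in M. J i \<omega> = j \<and> ?S \<omega> = k - j))"
    by (simp only:) (intro finite_measure_finite_Union, auto simp: disjoint_family_on_def)
  also have "\<dots> = (\<Sum>j = 0..k. pmf F j * fps_nth (Abs_fps (pmf F) ^ card I) (k - j))"
    by (simp add: joint law IH)
  finally show ?case
    using insert.hyps by (simp add: fps_mult_nth)
qed

text \<open>
  On the event \<open>N = n\<close> the random upper limit of the sum may be replaced by \<open>n\<close>, and the sum of the
  first \<open>n\<close> jumps is a function of the jump sequence, which is independent of \<open>N\<close>.
\<close>

lemma (in prob_space) prob_compound_sum_eq:
  fixes N :: "'a \<Rightarrow> nat" and J :: "nat \<Rightarrow> 'a \<Rightarrow> nat"
  assumes N: "distr M (count_space UNIV) N = measure_pmf Q"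
    and law: "\<And>i. i \<ge> 1 \<Longrightarrow> distr M (count_space UNIV) (J i) = measure_pmf F"
    and indep: "indep_vars (\<lambda>_. count_space UNIV) J {1..}"
    and indep_N: "indep_rv M (count_space UNIV) N
           (PiM {1..} (\<lambda>_. count_space UNIV)) (\<lambda>\<omega>. \<lambda>i\<in>{1..}. J i \<omega>)"
  shows "\<P>(\<omega> in M. N \<omega> = n \<and> (\<Sum>i = 1..N \<omega>. J i \<omega>) = k)
      = pmf Q n * fps_nth (Abs_fps (pmf F) ^ n) k"
proof -
  let ?\<Pi> = "PiM {1::nat..} (\<lambda>_. count_space (UNIV :: nat set))"
  let ?Z = "\<lambda>\<omega>. \<lambda>i\<in>{1..}. J i \<omega>"
  have [measurable]: "N \<in> measurable M (count_space UNIV)"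
    using indep_N by (simp add: indep_rv_def)
  let ?B = "{z \<in> space ?\<Pi>. (\<Sum>i = 1..n. z i) = k}"
  have "(\<lambda>z. \<Sum>i = 1..n. z i) \<in> measurable ?\<Pi> (count_space UNIV)"
    by (intro measurable_sum_nat measurable_component_singleton) auto
  then have B: "?B \<in> sets ?\<Pi>" by measurable
  have vB: "?Z -` ?B \<inter> space M = {\<omega> \<in> space M. (\<Sum>i = 1..n. J i \<omega>) = k}"
    by (auto simp: space_PiM)
  have "prob ((N -` {n} \<inter> space M) \<inter> (?Z -` ?B \<inter> space M))
      = prob (N -` {n} \<inter> space M) * prob (?Z -` ?B \<inter> space M)"
  proof (rule indep_setD)
    show "indep_set {N -` A \<inter> space M |A. A \<in> sets (count_space UNIV)}
        {?Z -` A \<inter> space M |A. A \<in> sets ?\<Pi>}"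
      using indep_N by (simp add: indep_rv_def)
    show "?Z -` ?B \<inter> space M \<in> {?Z -` A \<inter> space M |A. A \<in> sets ?\<Pi>}"
      using B by blast
  qed auto
  moreover have "(N -` {n} \<inter> space M) \<inter> (?Z -` ?B \<inter> space M)
      = {\<omega> \<in> space M. N \<omega> = n \<and> (\<Sum>i = 1..N \<omega>. J i \<omega>) = k}"
    unfolding vB by auto
  moreover have "prob (N -` {n} \<inter> space M) = pmf Q n"
    using measure_distr[of N M "count_space UNIV" "{n}"] by (simp add: N pmf.rep_eq)
  moreover have "\<P>(\<omega> in M. (\<Sum>i = 1..n. J i \<omega>) = k) = fps_nth (Abs_fps (pmf F) ^ n) k"
    using prob_iid_sum_eq[of "{1..n}" J F k] law indep_vars_subset[OF indep, of "{1..n}"] by auto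
  ultimately show ?thesis unfolding vB by simp
qed

text \<open>
  Each jump is almost surely at least \<open>1\<close>, and there are only countably many jumps.
\<close>

lemma (in prob_space) AE_le_compound_sum:
  fixes N :: "'a \<Rightarrow> nat" and J :: "nat \<Rightarrow> 'a \<Rightarrow> nat"
  assumes meas: "\<And>i. i \<ge> 1 \<Longrightarrow> J i \<in> measurable M (count_space UNIV)"
    and law: "\<And>i. i \<ge> 1 \<Longrightarrow> distr M (count_space UNIV) (J i) = measure_pmf F"
    and pos: "0 \<notin> set_pmf F"
  shows "AE \<omega> in M. N \<omega> \<le> (\<Sum>i = 1..N \<omega>. J i \<omega>)"
proof -
  have "AE \<omega> in M. J i \<omega> \<noteq> 0" if i: "i \<ge> 1" for i
  proof -
    have "AE j in distr M (count_space UNIV) (J i). j \<noteq> 0"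
      unfolding law[OF i] AE_measure_pmf_iff using pos by metis
    then show ?thesis using meas[OF i] by (subst (asm) AE_distr_iff) auto
  qed
  then have "AE \<omega> in M. \<forall>i. i \<ge> 1 \<longrightarrow> J i \<omega> \<noteq> 0"
    by (simp add: AE_all_countable)
  then show ?thesis
  proof eventually_elim
    case (elim \<omega>)
    have "(\<Sum>i = 1..N \<omega>. 1) \<le> (\<Sum>i = 1..N \<omega>. J i \<omega>)"
      using elim by (intro sum_mono) (auto simp: Suc_le_eq)
    then show ?case by simp
  qed
qed

lemma (in prob_space) bounded_nat_expectation:
  fixes N :: "'a \<Rightarrow> nat"
  assumes [measurable]: "N \<in> measurable M (count_space UNIV)" and le: "AE \<omega> in M. N \<omega> \<le> K"
  shows "integrable M (\<lambda>\<omega>. real (N \<omega>))"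
    and "expectation (\<lambda>\<omega>. real (N \<omega>)) = (\<Sum>n = 1..K. \<P>(\<omega> in M. n \<le> N \<omega>))"
proof -
  show "integrable M (\<lambda>\<omega>. real (N \<omega>))"
    using le by (intro integrable_const_bound[of _ "real K"]) auto
  have "expectation (\<lambda>\<omega>. real (N \<omega>))
      = expectation (\<lambda>\<omega>. \<Sum>n = 1..K. indicator {\<omega> \<in> space M. n \<le> N \<omega>} \<omega>)"
  proof (rule integral_cong_AE)
    show "AE \<omega> in M. real (N \<omega>) = (\<Sum>n = 1..K. indicator {\<omega> \<in> space M. n \<le> N \<omega>} \<omega>)"
      using le AE_space
    proof eventually_elim
      case (elim \<omega>)
      then have "{1..K} \<inter> {n. n \<le> N \<omega>} = {1..N \<omega>}" by auto
      then show ?case using elim by (simp add: indicator_def sum.If_cases)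
    qed
  qed auto
  also have "\<dots> = (\<Sum>n = 1..K. \<P>(\<omega> in M. n \<le> N \<omega>))"
  proof -
    have [measurable]: "{\<omega> \<in> space M. n \<le> N \<omega>} \<in> events" for n by measurable
    show ?thesis
      by (subst Bochner_Integration.integral_sum)
         (auto simp: less_top[symmetric]
           intro!: sum.cong integrable_real_indicator arg_cong[where f=prob])
  qed
  finally show "expectation (\<lambda>\<omega>. real (N \<omega>)) = (\<Sum>n = 1..K. \<P>(\<omega> in M. n \<le> N \<omega>))" .
qed

section \<open>Monotonicity of the posterior\<close>

theorem lemma3p11:
  fixes M :: "'a measure" and Q F :: "nat pmf"
    and N X :: "'a \<Rightarrow> nat" and J :: "nat \<Rightarrow> 'a \<Rightarrow> nat"
  assumes "prob_space M"
    and "0 \<notin> set_pmf F"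
    and "N \<in> measurable M (count_space UNIV)"
    and "distr M (count_space UNIV) N = measure_pmf Q"
    and "\<And>i. i \<ge> 1 \<Longrightarrow> J i \<in> measurable M (count_space UNIV)"
    and "\<And>i. i \<ge> 1 \<Longrightarrow> distr M (count_space UNIV) (J i) = measure_pmf F"
    and "prob_space.indep_vars M (\<lambda>_. count_space UNIV) J {1..}"
    and "indep_rv M (count_space UNIV) N
           (PiM {1..} (\<lambda>_. count_space UNIV)) (\<lambda>\<omega>. \<lambda>i\<in>{1..}. J i \<omega>)"
    and "\<And>\<omega>. \<omega> \<in> space M \<Longrightarrow> X \<omega> = (\<Sum>i = 1..N \<omega>. J i \<omega>)"
    and "PF2_pmf F"
  shows "TP2_on UNIV (supp_rv M X) (\<lambda>n k. \<P>(\<omega> in M. N \<omega> = n \<bar> X \<omega> = k))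
    \<and> (\<forall>k\<in>supp_rv M X. \<forall>k'\<in>supp_rv M X. k \<le> k' \<longrightarrow>
         (\<forall>n. \<P>(\<omega> in M. N \<omega> \<ge> n \<bar> X \<omega> = k) \<le> \<P>(\<omega> in M. N \<omega> \<ge> n \<bar> X \<omega> = k')))
    \<and> (\<forall>k\<in>supp_rv M X.
         integrable (uniform_measure M {\<omega> \<in> space M. X \<omega> = k}) (\<lambda>\<omega>. real (N \<omega>)))
    \<and> mono_on (supp_rv M X) (cond_mean M (\<lambda>\<omega>. real (N \<omega>)) X)"
proof -
  interpret prob_space M by fact
  let ?S = "supp_rv M X"
  let ?w = "\<lambda>n k. \<P>(\<omega> in M. N \<omega> = n \<bar> X \<omega> = k)"
  let ?c = "\<lambda>n k. fps_nth (Abs_fps (pmf F) ^ n) k"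
  have N[measurable]: "N \<in> measurable M (count_space UNIV)" by fact
  have [measurable]: "X \<in> measurable M (count_space UNIV)"
  proof -
    have "(\<lambda>\<omega>. \<Sum>i = 1..N \<omega>. J i \<omega>) \<in> measurable M (count_space UNIV)"
    proof (rule measurable_compose_countable[OF _ N])
      show "(\<lambda>\<omega>. \<Sum>i = 1..n. J i \<omega>) \<in> measurable M (count_space UNIV)" for n
        using assms(5) by (intro measurable_sum_nat) auto
    qed
    then show ?thesis using assms(9) by (subst measurable_cong) auto
  qed
  have NX: "AE \<omega> in M. N \<omega> \<le> X \<omega>"
  proof -
    have "AE \<omega> in M. N \<omega> \<le> (\<Sum>i = 1..N \<omega>. J i \<omega>)"
      by (intro AE_le_compound_sum[where F = F] assms)
    then show ?thesis using AE_space by eventually_elim (simp add: assms(9))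
  qed
  have joint: "\<P>(\<omega> in M. N \<omega> = n \<and> X \<omega> = k) = pmf Q n * ?c n k" for n k
  proof -
    have "\<P>(\<omega> in M. N \<omega> = n \<and> X \<omega> = k) = \<P>(\<omega> in M. N \<omega> = n \<and> (\<Sum>i = 1..N \<omega>. J i \<omega>) = k)"
      using assms(9) by (intro arg_cong[where f=prob]) auto
    also have "\<dots> = pmf Q n * ?c n k"
      by (intro prob_compound_sum_eq assms)
    finally show ?thesis .
  qed
  have w: "?w n k = pmf Q n * ?c n k / \<P>(\<omega> in M. X \<omega> = k)" for n k
    by (simp add: cond_prob_def joint)

  have c: "TP2_on UNIV UNIV ?c"
    by (intro TP2_fps_power PF2_pmf_TP2_toeplitz assms)
  have TP2: "TP2_on UNIV ?S ?w"
    unfolding TP2_on_def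
  proof (intro conjI ballI impI)
    show "0 \<le> ?w n k" for n k by (simp add: cond_prob_def)
  next
    fix n n' k k' :: nat assume le: "n \<le> n' \<and> k \<le> k'"
    let ?r = "pmf Q n * pmf Q n' / (\<P>(\<omega> in M. X \<omega> = k) * \<P>(\<omega> in M. X \<omega> = k'))"
    have "?r * (?c n k' * ?c n' k) \<le> ?r * (?c n k * ?c n' k')"
      using c le unfolding TP2_on_def by (intro mult_left_mono) auto
    then show "?w n k' * ?w n' k \<le> ?w n k * ?w n' k'"
      unfolding w by (simp add: mult_ac)
  qed

  \<comment> \<open>Since \<open>N \<le> X\<close> almost surely, the posterior given \<open>X = k\<close> lives on \<open>{..K}\<close> for any \<open>K \<ge> k\<close>.
    Having \<open>K\<close> at hand allows two values of \<open>k\<close> to share one range of summation.\<close>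
  have tail: "\<P>(\<omega> in M. N \<omega> \<ge> n \<bar> X \<omega> = k) = (\<Sum>m\<in>{n..K}. ?w m k)" if "k \<le> K" for n k K
  proof -
    have "\<P>(\<omega> in M. n \<le> N \<omega> \<and> X \<omega> = k) = prob (\<Union>m\<in>{n..K}. {\<omega> \<in> space M. N \<omega> = m \<and> X \<omega> = k})"
    proof (rule finite_measure_eq_AE)
      show "AE \<omega> in M. \<omega> \<in> {\<omega> \<in> space M. n \<le> N \<omega> \<and> X \<omega> = k} \<longleftrightarrow>
          \<omega> \<in> (\<Union>m\<in>{n..K}. {\<omega> \<in> space M. N \<omega> = m \<and> X \<omega> = k})"
        using NX by eventually_elim (use that in auto)
    qed measurable
    also have "\<dots> = (\<Sum>m\<in>{n..K}. \<P>(\<omega> in M. N \<omega> = m \<and> X \<omega> = k))"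
      by (intro finite_measure_finite_Union) (auto simp: disjoint_family_on_def)
    finally show ?thesis by (simp add: cond_prob_def sum_divide_distrib)
  qed

  have incr: "\<P>(\<omega> in M. N \<omega> \<ge> n \<bar> X \<omega> = k) \<le> \<P>(\<omega> in M. N \<omega> \<ge> n \<bar> X \<omega> = k')"
    if k: "k \<in> ?S" "k' \<in> ?S" "k \<le> k'" for n k k'
  proof -
    \<comment> \<open>The tail from \<open>0\<close> is the total mass.\<close>
    have "(\<Sum>m\<le>k'. ?w m x) = 1" if "x \<in> ?S" "x \<le> k'" for x
      using tail[OF that(2), of 0] that(1)
      by (simp add: atLeast0AtMost cond_prob_def supp_rv_def)
    then show ?thesis
      using TP2_stochastically_increasing[OF TP2 k, of k' n] k by (simp add: tail[of _ k'])
  qed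

  have mean: "integrable (uniform_measure M {\<omega> \<in> space M. X \<omega> = k}) (\<lambda>\<omega>. real (N \<omega>))"
      "cond_mean M (\<lambda>\<omega>. real (N \<omega>)) X k = (\<Sum>n = 1..K. \<P>(\<omega> in M. N \<omega> \<ge> n \<bar> X \<omega> = k))"
    if k: "k \<in> ?S" "k \<le> K" for k K
  proof -
    let ?A = "{\<omega> \<in> space M. X \<omega> = k}"
    let ?U = "uniform_measure M ?A"
    have A: "emeasure M ?A \<noteq> 0" "emeasure M ?A \<noteq> \<infinity>"
      using k(1) by (auto simp: supp_rv_def emeasure_eq_measure)
    interpret U: prob_space ?U using A by (rule prob_space_uniform_measure)
    have NU: "N \<in> measurable ?U (count_space UNIV)" by simp
    have le: "AE \<omega> in ?U. N \<omega> \<le> K"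
    proof (rule AE_uniform_measureI)
      show "AE \<omega> in M. \<omega> \<in> ?A \<longrightarrow> N \<omega> \<le> K"
        using NX by eventually_elim (use k(2) in auto)
    qed measurable
    have "\<P>(\<omega> in ?U. n \<le> N \<omega>) = \<P>(\<omega> in M. N \<omega> \<ge> n \<bar> X \<omega> = k)" for n
    proof -
      have "?A \<inter> {\<omega> \<in> space M. n \<le> N \<omega>} = {\<omega> \<in> space M. n \<le> N \<omega> \<and> X \<omega> = k}" by auto
      then show ?thesis using A by (simp add: cond_prob_def)
    qed
    then show "integrable ?U (\<lambda>\<omega>. real (N \<omega>))"
      "cond_mean M (\<lambda>\<omega>. real (N \<omega>)) X k = (\<Sum>n = 1..K. \<P>(\<omega> in M. N \<omega> \<ge> n \<bar> X \<omega> = k))"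
      using U.bounded_nat_expectation[OF NU le] by (simp_all add: cond_mean_def)
  qed

  have "mono_on ?S (cond_mean M (\<lambda>\<omega>. real (N \<omega>)) X)"
  proof (rule mono_onI)
    fix k k' assume k: "k \<in> ?S" "k' \<in> ?S" "k \<le> k'"
    show "cond_mean M (\<lambda>\<omega>. real (N \<omega>)) X k \<le> cond_mean M (\<lambda>\<omega>. real (N \<omega>)) X k'"
      unfolding mean(2)[OF k(1) k(3)] mean(2)[OF k(2) order_refl]
      by (intro sum_mono incr k)
  qed
  with TP2 incr mean(1) show ?thesis by blast
qed

end
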